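(* Let $K_\ell$ be an $\ell\times\ell$ binary kernel that is self-dual, and let $f_1(z),\dots,f_\ell(z)$ be its polarization behavior. Then for every $i=1,\dots,\ell$, $$f_{\ell+1-i}(z)=1-f_i(1-z).$$
   Context: Let $K_\ell$ be an $\ell\times\ell$ binary matrix (kernel) with rows $g_1,\dots,g_\ell\in\mathbb F_2^\ell$. Its kernel codes are $\mathcal C_i=\langle g_{i+1},\dots,g_\ell\rangle$ for $i=0,\dots,\ell-1$ (linear span over $\mathbb F_2$), and $\mathcal C_\ell=\{0\}$. The kernel is self-dual if $\mathcal C_i=\mathcal C_{\ell-i}^{\perp}$ for all $i=0,\dots,\ell$, where $\perp$ is the dual with respect to the standard inner product on $\mathbb F_2^\ell$. An erasure pattern is a vector $\mathbf e\in\{0,1\}^\ell$ ($1$ = erased, $0$ = unerased). It is uncorrectable for the $i$-th bit-channel $W_i$ if there exist $\mathbf u',\mathbf u''\in\mathbb F_2^\ell$ with $u'_j=u''_j$ for all $j<i$, $u'_i\ne u''_i$, and $(\mathbf u'K_\ell)_j=(\mathbf u''K_\ell)_j$ for all $j$ with $e_j=0$. $E_{i,w}$ denotes the number of erasure patterns of Hamming weight $w$ that are uncorrectable for $W_i$. The polarization behavior consists of the polynomials $f_i(z)=\sum_{w=0}^{\ell}E_{i,w}z^w(1-z)^{\ell-w}$, $i=1,\dots,\ell$ ($f_i(z)$ is the erasure probability of $W_i$ when each coordinate is erased independently with probability $z$). *)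

theory Defs
  imports
    "Jordan_Normal_Form.VS_Connect"
    "HOL-Library.Z2"
    "HOL-Computational_Algebra.Polynomial"
begin

text \<open>
  The field with two elements is \<^typ>\<open>bit\<close>. Entries of vectors and matrices are numbered from 0
  in the library, so coordinate \<open>j\<close> (row \<open>j\<close>) in the usual numbering \<open>1, \<dots>, l\<close> has library
  index \<open>j - 1\<close>. The indices \<open>i\<close> of kernel codes (\<open>0, \<dots>, l\<close>) and of bit-channels
  (\<open>1, \<dots>, l\<close>) below keep their usual numbering.
\<close>

text \<open>
  The rows numbered \<open>i + 1, \<dots>, l\<close> have library indices \<open>i, \<dots>, l - 1\<close>; for \<open>i = l\<close> there
  are none and the span is the zero space.
\<close>

definition kernel_code :: "nat \<Rightarrow> bit mat \<Rightarrow> nat \<Rightarrow> bit vec set" where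
  "kernel_code l K i =
     LinearCombinations.module.span class_ring (module_vec TYPE(bit) l) (row K ` {i..<l})"

lemma kernel_code_last: "kernel_code l K l = {0\<^sub>v l}"
proof -
  interpret vec_space "TYPE(bit)" l .
  have "{l..<l} = {}" by simp
  then show ?thesis
    unfolding kernel_code_def by (metis image_empty span_empty)
qed

definition self_dual_kernel :: "nat \<Rightarrow> bit mat \<Rightarrow> bool" where
  "self_dual_kernel l K \<longleftrightarrow>
     (\<forall>i\<le>l. kernel_code l K i = vec_module.orthogonal_complement l (kernel_code l K (l - i)))"

text \<open>The product of a row vector with a matrix, written through the transpose.\<close>

definition encode :: "bit mat \<Rightarrow> bit vec \<Rightarrow> bit vec" where
  "encode K u = transpose_mat K *\<^sub>v u"

text \<open>An erasure pattern is a \<^typ>\<open>bit vec\<close> of dimension \<open>l\<close> whose 1-entries are the erasures.\<close>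

definition uncorrectable :: "nat \<Rightarrow> bit mat \<Rightarrow> nat \<Rightarrow> bit vec \<Rightarrow> bool" where
  "uncorrectable l K i e \<longleftrightarrow>
     (\<exists>u'\<in>carrier_vec l. \<exists>u''\<in>carrier_vec l.
        (\<forall>j\<in>{1..<i}. u' $ (j - 1) = u'' $ (j - 1)) \<and>
        u' $ (i - 1) \<noteq> u'' $ (i - 1) \<and>
        (\<forall>j\<in>{1..l}. e $ (j - 1) = 0 \<longrightarrow> encode K u' $ (j - 1) = encode K u'' $ (j - 1)))"

definition hamming_weight :: "bit vec \<Rightarrow> nat" where
  "hamming_weight e = card {j. j < dim_vec e \<and> e $ j \<noteq> 0}"

definition num_uncorrectable :: "nat \<Rightarrow> bit mat \<Rightarrow> nat \<Rightarrow> nat \<Rightarrow> nat" where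
  "num_uncorrectable l K i w =
     card {e \<in> carrier_vec l. hamming_weight e = w \<and> uncorrectable l K i e}"

text \<open>Here \<open>[:0, 1:]\<close> is the indeterminate \<open>z\<close> and \<open>[:1, -1:]\<close> is \<open>1 - z\<close>.\<close>

definition polarization_poly :: "nat \<Rightarrow> bit mat \<Rightarrow> nat \<Rightarrow> real poly" where
  "polarization_poly l K i =
     (\<Sum>w = 0..l. of_nat (num_uncorrectable l K i w) * [:0, 1:] ^ w * [:1, -1:] ^ (l - w))"

end

(*
  A pattern with erasure set E is uncorrectable for W_i iff some codeword of C_{i-1} that is not
  in C_i is supported in E. If no such word exists, then for any g in C_{i-1} outside C_i we have
  g not in C_i + F_2^E, so a linear functional d vanishes on C_i and on F_2^E but not at g; then d
  is supported off E and lies in the dual of C_i but not in that of C_{i-1}, that is, in C_{l-i}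
  but not in C_{l+1-i}. Conversely two such words cannot coexist, as their supports would be
  disjoint. Hence E is uncorrectable for W_{l+1-i} iff its complement is correctable for W_i, and
  complementing exchanges z and 1 - z.
*)
theory Submission
  imports Defs
begin

section \<open>Functionals, separation and dual supports over the two-element field\<close>

lemma bit_vec_plus_self:
  fixes v :: "bit vec"
  assumes "v \<in> carrier_vec n"
  shows "v + v = 0\<^sub>v n"
  using assms by (intro eq_vecI) auto

lemma bit_vec_plus_cancel:
  fixes v w :: "bit vec"
  assumes "v \<in> carrier_vec n" "w \<in> carrier_vec n"
  shows "v + w + w = v"
  using assms by (simp add: assoc_add_vec[of _ n] bit_vec_plus_self)

text \<open>Over the two-element field additivity is already linearity, so the values at the unit
  vectors determine the functional. The induction builds \<open>x\<close> up from its truncations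
  \<open>?t k\<close> to the first \<open>k\<close> coordinates.\<close>

lemma bit_vec_additive_eq_scalar_prod:
  fixes \<phi> :: "bit vec \<Rightarrow> bit"
  assumes add: "\<And>x y. x \<in> carrier_vec n \<Longrightarrow> y \<in> carrier_vec n \<Longrightarrow> \<phi> (x + y) = \<phi> x + \<phi> y"
    and x: "x \<in> carrier_vec n"
  shows "\<phi> x = vec n (\<lambda>j. \<phi> (unit_vec n j)) \<bullet> x"
proof -
  let ?t = "\<lambda>k. vec n (\<lambda>j. if j < k then x $ j else 0)"
  have zero: "\<phi> (0\<^sub>v n) = 0"
    using add[of "0\<^sub>v n" "0\<^sub>v n"] by simp
  have "\<phi> (?t k) = (\<Sum>j<k. \<phi> (unit_vec n j) * x $ j)" if "k \<le> n" for k
    using that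
  proof (induction k)
    case 0
    have "?t 0 = 0\<^sub>v n" by auto
    then show ?case using zero by simp
  next
    case (Suc k)
    have "?t (Suc k) = ?t k + x $ k \<cdot>\<^sub>v unit_vec n k"
      using Suc.prems by (intro eq_vecI) (auto simp: less_Suc_eq)
    moreover have "\<phi> (x $ k \<cdot>\<^sub>v unit_vec n k) = \<phi> (unit_vec n k) * x $ k"
    proof (cases "x $ k")
      case zero
      moreover have "0 \<cdot>\<^sub>v unit_vec n k = (0\<^sub>v n :: bit vec)" by auto
      ultimately show ?thesis using \<open>\<phi> (0\<^sub>v n) = 0\<close> by simp
    next
      case one
      then show ?thesis by simp
    qed
    ultimately show ?case
      using Suc by (simp add: add)
  qed
  from this[of n] have "\<phi> (?t n) = (\<Sum>j<n. \<phi> (unit_vec n j) * x $ j)" by simp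
  moreover have "?t n = x" using x by (intro eq_vecI) auto
  ultimately show ?thesis
    using x by (simp add: scalar_prod_def lessThan_atLeast0)
qed

text \<open>Serves twice: it makes the vector space finite, and it lets sums over erasure patterns
  run over subsets of coordinates.\<close>

lemma bij_betw_indicator_bit_vec:
  "bij_betw (\<lambda>S. vec n (\<lambda>j. of_bool (j \<in> S)) :: bit vec) (Pow {..<n}) (carrier_vec n)"
proof (rule bij_betw_byWitness[where f' = "\<lambda>e. {j. j < n \<and> e $ j \<noteq> 0}"])
  show "\<forall>e\<in>carrier_vec n. vec n (\<lambda>j. of_bool (j \<in> {j. j < n \<and> e $ j \<noteq> 0})) = (e :: bit vec)"
    by (auto intro!: eq_vecI)
qed (auto split: if_splits)

lemma finite_carrier_bit_vec: "finite (carrier_vec n :: bit vec set)"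
  using bij_betw_finite[OF bij_betw_indicator_bit_vec[of n]] by simp

text \<open>Over the two-element field, a set containing zero and closed under addition is a
  subspace. As the space is finite, \<open>W\<close> extends to a subspace maximal among those
  avoiding \<open>g\<close>. Maximality leaves room for one further coset only, and the functional
  tells the two cosets apart.\<close>

lemma bit_vec_separation:
  fixes W :: "bit vec set"
  assumes W: "W \<subseteq> carrier_vec n" "0\<^sub>v n \<in> W"
    and W_add: "\<And>x y. x \<in> W \<Longrightarrow> y \<in> W \<Longrightarrow> x + y \<in> W"
    and g: "g \<in> carrier_vec n" "g \<notin> W"
  obtains d where "d \<in> carrier_vec n" "\<And>w. w \<in> W \<Longrightarrow> d \<bullet> w = 0" "d \<bullet> g = 1"
proof -
  define A where "A = {M. M \<subseteq> carrier_vec n \<and> 0\<^sub>v n \<in> M \<and> (\<forall>x\<in>M. \<forall>y\<in>M. x + y \<in> M) \<and> g \<notin> M}"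
  have "finite A"
    unfolding A_def by (rule finite_subset[of _ "Pow (carrier_vec n)"])
      (auto simp: finite_carrier_bit_vec)
  moreover have "W \<in> A" using assms by (auto simp: A_def)
  ultimately obtain M where M: "M \<in> A" "W \<subseteq> M" and max: "\<And>N. N \<in> A \<Longrightarrow> M \<subseteq> N \<Longrightarrow> M = N"
    using finite_has_maximal2[of A W] by metis
  have carr: "x \<in> carrier_vec n" if "x \<in> M" for x using that M by (auto simp: A_def)
  have add: "x + y \<in> M" if "x \<in> M" "y \<in> M" for x y using that M by (auto simp: A_def)
  have zero: "0\<^sub>v n \<in> M" and gM: "g \<notin> M" using M by (auto simp: A_def)
  \<comment> \<open>By maximality \<open>M\<close> has index two, so that its indicator is an additive functional.\<close>
  have coset: "x + g \<in> M" if x: "x \<in> carrier_vec n" "x \<notin> M" for x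
  proof -
    \<comment> \<open>\<open>N\<close> is the subspace generated by \<open>M\<close> and
      \<open>x\<close>. Being strictly larger than \<open>M\<close>, it must contain
      \<open>g\<close>, and this can only happen in the coset of \<open>x\<close>.\<close>
    define N where "N = M \<union> (\<lambda>m. m + x) ` M"
    have "x \<in> N" unfolding N_def using zero x by (force intro!: image_eqI[of _ _ "0\<^sub>v n"])
    then have "N \<notin> A" using max[of N] x by (auto simp: N_def)
    moreover have "a + b \<in> N" if "a \<in> N" "b \<in> N" for a b
    proof -
      obtain a' b' where ab: "a' \<in> M" "a = a' \<or> a = a' + x" "b' \<in> M" "b = b' \<or> b = b' + x"
        using \<open>a \<in> N\<close> \<open>b \<in> N\<close> by (auto simp: N_def)
      note c = carr[OF ab(1)] carr[OF ab(3)] x(1)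
      have "a' + x + b' = a' + b' + x"
        using c by (auto simp: ac_simps)
      moreover have "a' + (b' + x) = a' + b' + x"
        using c by (auto simp: ac_simps)
      moreover have "a' + x + (b' + x) = a' + b'"
        using c by (intro eq_vecI) (auto simp: ac_simps)
      ultimately show ?thesis using ab add[of a' b'] by (auto simp: N_def)
    qed
    moreover have "N \<subseteq> carrier_vec n" "0\<^sub>v n \<in> N"
      using carr x zero by (auto simp: N_def)
    ultimately have "g \<in> N" by (auto simp: A_def)
    then obtain m where m: "m \<in> M" "g = m + x" using gM by (auto simp: N_def)
    have "x + g = m" using m carr[of m] x by (intro eq_vecI) (auto simp: ac_simps)
    then show ?thesis using m by simp
  qed
  define \<phi> :: "bit vec \<Rightarrow> bit" where "\<phi> x = of_bool (x \<notin> M)" for x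
  have "\<phi> (x + y) = \<phi> x + \<phi> y" if xy: "x \<in> carrier_vec n" "y \<in> carrier_vec n" for x y
  proof -
    have "x + y \<in> M" if "x \<notin> M" "y \<notin> M"
    proof -
      \<comment> \<open>Shifting by \<open>g\<close> moves both vectors into \<open>M\<close>, and
        the two copies of \<open>g\<close> cancel in the sum.\<close>
      have "(x + g) + (y + g) \<in> M" using that xy coset add by blast
      moreover have "(x + g) + (y + g) = x + y"
        using xy g by (intro eq_vecI) (auto simp: ac_simps)
      ultimately show ?thesis by simp
    qed
    moreover have "y \<in> M" if "x \<in> M" "x + y \<in> M"
    proof -
      have "x + (x + y) = y" using xy by (intro eq_vecI) (auto simp: ac_simps)
      then show ?thesis using add[OF that] by simp
    qed
    moreover have "x \<in> M" if "y \<in> M" "x + y \<in> M"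
      using add[OF that(2,1)] bit_vec_plus_cancel[OF xy] by simp
    ultimately show ?thesis
      using add[of x y] by (auto simp: \<phi>_def)
  qed
  then have rep: "vec n (\<lambda>j. \<phi> (unit_vec n j)) \<bullet> x = \<phi> x" if "x \<in> carrier_vec n" for x
    using bit_vec_additive_eq_scalar_prod[of n \<phi>] that by metis
  show thesis
  proof (rule that[of "vec n (\<lambda>j. \<phi> (unit_vec n j))"])
    show "vec n (\<lambda>j. \<phi> (unit_vec n j)) \<bullet> w = 0" if "w \<in> W" for w
    proof -
      have "w \<in> M" "w \<in> carrier_vec n" using that M(2) W(1) by auto
      then show ?thesis using rep[of w] by (simp add: \<phi>_def)
    qed
  qed (use rep[of g] g gM in \<open>auto simp: \<phi>_def\<close>)
qed

text \<open>The last two assumptions say that \<open>D\<close> has index two in \<open>C\<close>. A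
  vector orthogonal to \<open>D\<close> but not to \<open>C\<close> thus has product 1 with every
  element of \<open>C - D\<close>, which is impossible for one whose support is disjoint from its
  own. The other implication is an instance of \<open>bit_vec_separation\<close>.\<close>

lemma complementary_support_duality:
  fixes C D :: "bit vec set"
  assumes C: "C \<subseteq> carrier_vec n"
    and D: "0\<^sub>v n \<in> D" "\<And>x y. x \<in> D \<Longrightarrow> y \<in> D \<Longrightarrow> x + y \<in> D" "D \<subset> C"
    and coset: "\<And>x y. x \<in> C - D \<Longrightarrow> y \<in> D \<Longrightarrow> x + y \<in> C - D"
    and index2: "\<And>x y. x \<in> C - D \<Longrightarrow> y \<in> C - D \<Longrightarrow> x + y \<in> D"
  shows "(\<exists>d \<in> vec_module.orthogonal_complement n D - vec_module.orthogonal_complement n C.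
            \<forall>j<n. j \<in> E \<longrightarrow> d $ j = 0) \<longleftrightarrow>
         \<not> (\<exists>c \<in> C - D. \<forall>j<n. j \<notin> E \<longrightarrow> c $ j = 0)"
proof -
  have perp: "vec_module.orthogonal_complement n X =
      {x \<in> carrier_vec n. \<forall>y\<in>X. x \<bullet> y = 0}" for X :: "bit vec set"
    by (simp add: vec_module.orthogonal_complement_def)
  have Dc: "x \<in> carrier_vec n" if "x \<in> D" for x using that C D by auto
  show ?thesis
  proof (intro iffI notI)
    assume "\<exists>d \<in> vec_module.orthogonal_complement n D - vec_module.orthogonal_complement n C.
      \<forall>j<n. j \<in> E \<longrightarrow> d $ j = 0"
    then obtain d x where d: "d \<in> carrier_vec n" "\<And>y. y \<in> D \<Longrightarrow> d \<bullet> y = 0"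
      "\<And>j. j < n \<Longrightarrow> j \<in> E \<Longrightarrow> d $ j = 0" and x: "x \<in> C" "d \<bullet> x \<noteq> 0"
      using C by (fastforce simp: perp)
    assume "\<exists>c \<in> C - D. \<forall>j<n. j \<notin> E \<longrightarrow> c $ j = 0"
    then obtain c where c: "c \<in> C - D" "\<And>j. j < n \<Longrightarrow> j \<notin> E \<Longrightarrow> c $ j = 0"
      by auto
    have cx: "c \<in> carrier_vec n" "x \<in> carrier_vec n" using c x C by auto
    have "d $ j * c $ j = 0" if "j < n" for j
      using d(3)[OF that] c(2)[OF that] by (cases "j \<in> E") auto
    then have "d \<bullet> c = 0" using cx unfolding scalar_prod_def
      by (intro sum.neutral) auto
    \<comment> \<open>Since \<open>d\<close> is not orthogonal to \<open>x\<close>, the vector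
      \<open>x\<close> lies outside \<open>D\<close>, in the same coset as \<open>c\<close>.\<close>
    moreover have "x + c \<in> D" using x d(2) c index2 by blast
    then have "d \<bullet> (x + c) = 0" by (rule d(2))
    ultimately show False
      using x d(1) cx by (simp add: scalar_prod_add_distrib[of _ n])
  next
    assume *: "\<not> (\<exists>c \<in> C - D. \<forall>j<n. j \<notin> E \<longrightarrow> c $ j = 0)"
    obtain c where c: "c \<in> C - D" using D by auto
    define F :: "bit vec set" where
      "F = {f \<in> carrier_vec n. \<forall>j<n. j \<notin> E \<longrightarrow> f $ j = 0}"
    \<comment> \<open>A vector orthogonal to \<open>W\<close> is orthogonal to \<open>D\<close> and,
      because \<open>F\<close> contains the unit vectors at positions in \<open>E\<close>, vanishes
      on \<open>E\<close>. It remains to separate \<open>c\<close> from \<open>W\<close>.\<close>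
    define W where "W = {x + f | x f. x \<in> D \<and> f \<in> F}"
    have F0: "0\<^sub>v n \<in> F" by (auto simp: F_def)
    have DW: "x \<in> W" if "x \<in> D" for x
    proof -
      have "x = x + 0\<^sub>v n" using Dc[OF that] by simp
      then show ?thesis unfolding W_def using that F0 by blast
    qed
    have FW: "f \<in> W" if "f \<in> F" for f
    proof -
      have "f = 0\<^sub>v n + f" using that by (simp add: F_def)
      then show ?thesis unfolding W_def using that D(1) by blast
    qed
    have W_add: "a + b \<in> W" if ab: "a \<in> W" "b \<in> W" for a b
    proof -
      obtain x f y g where h: "a = x + f" "b = y + g" "x \<in> D" "f \<in> F" "y \<in> D" "g \<in> F"
        using ab by (auto simp: W_def)
      have "a + b = (x + y) + (f + g)"
        using h Dc[of x] Dc[of y] by (intro eq_vecI) (auto simp: F_def ac_simps)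
      moreover have "x + y \<in> D" "f + g \<in> F" using h D(2) by (auto simp: F_def)
      ultimately show ?thesis unfolding W_def by blast
    qed
    have "c \<notin> W"
    proof
      assume "c \<in> W"
      then obtain x f where h: "c = x + f" "x \<in> D" "f \<in> F" by (auto simp: W_def)
      \<comment> \<open>In characteristic two, adding \<open>x\<close> again removes it. So
        \<open>f\<close> is a translate of \<open>c\<close> by an element of \<open>D\<close>, hence
        a word of \<open>C - D\<close> supported in \<open>E\<close>, which was excluded.\<close>
      have "c + x = f"
        using h Dc[of x] by (intro eq_vecI) (auto simp: F_def ac_simps)
      then have "f \<in> C - D" using coset[OF c h(2)] by simp
      then show False using * h(3) unfolding F_def by blast
    qed
    moreover have "W \<subseteq> carrier_vec n" using Dc by (auto simp: W_def F_def)
    moreover have "c \<in> carrier_vec n" using c C by auto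
    ultimately obtain d where d: "d \<in> carrier_vec n" "\<And>w. w \<in> W \<Longrightarrow> d \<bullet> w = 0" "d \<bullet> c = 1"
      using bit_vec_separation[of W n c] W_add DW[OF D(1)] by blast
    have "d $ j = 0" if j: "j < n" "j \<in> E" for j
    proof -
      have "unit_vec n j \<in> F" using j by (auto simp: F_def)
      then show ?thesis using d(2)[OF FW] d(1) j by fastforce
    qed
    moreover have "d \<in> vec_module.orthogonal_complement n D - vec_module.orthogonal_complement n C"
      using d DW c by (auto simp: perp)
    ultimately show "\<exists>d \<in> vec_module.orthogonal_complement n D - vec_module.orthogonal_complement n C.
      \<forall>j<n. j \<in> E \<longrightarrow> d $ j = 0" by blast
  qed
qed

section \<open>Encoding, kernel codes and uncorrectable patterns\<close>

lemma encode_carrier [simp]: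
  "K \<in> carrier_mat l l \<Longrightarrow> encode K u \<in> carrier_vec l"
  unfolding encode_def carrier_vec_def carrier_mat_def by auto

lemma encode_add:
  assumes "K \<in> carrier_mat l l" "u \<in> carrier_vec l" "v \<in> carrier_vec l"
  shows "encode K (u + v) = encode K u + encode K v"
  unfolding encode_def by (rule mult_add_distrib_mat_vec[of _ l l]) (use assms in simp_all)

lemma encode_index:
  assumes "K \<in> carrier_mat l l" "u \<in> carrier_vec l" "k < l"
  shows "encode K u $ k = (\<Sum>j<l. K $$ (j, k) * u $ j)"
proof -
  have "dim_row K = l" "dim_col K = l" "dim_vec u = l" using assms by auto
  then show ?thesis
    using assms(3) by (auto simp: encode_def scalar_prod_def lessThan_atLeast0 intro!: sum.cong)
qed

text \<open>The span of the last rows is the row space of the matrix \<open>B\<close> they form,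
  hence the image of its transpose. Padding a coefficient vector with \<open>i\<close> leading zeros
  turns it into a message for all of \<open>K\<close>.\<close>

lemma kernel_code_eq:
  assumes K: "K \<in> carrier_mat l l" and i: "i \<le> l"
  shows "kernel_code l K i = encode K ` {u \<in> carrier_vec l. \<forall>j<i. u $ j = 0}"
proof -
  interpret vec_space "TYPE(bit)" l .
  define B where "B = mat_of_rows l (map (row K) [i..<l])"
  have rows: "set (map (row K) [i..<l]) \<subseteq> carrier_vec l" using K by auto
  have B: "B \<in> carrier_mat (l - i) l" unfolding B_def by auto
  have "kernel_code l K i = row_space B"
    unfolding kernel_code_def row_space_def B_def using rows by (subst rows_mat_of_rows) auto
  also have "\<dots> = {B\<^sup>T *\<^sub>v y | y. y \<in> carrier_vec (l - i)}"
    using B by (subst row_space_eq[OF B]) auto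
  also have "\<dots> = encode K ` {u \<in> carrier_vec l. \<forall>j<i. u $ j = 0}"
  proof -
    \<comment> \<open>Stated for any \<open>u\<close> with tail \<open>y\<close>, so that it serves
      both inclusions: one pads \<open>y\<close>, the other truncates \<open>u\<close>.\<close>
    have key: "B\<^sup>T *\<^sub>v y = encode K u"
      if u: "u \<in> carrier_vec l" "\<forall>j<i. u $ j = 0"
        and y: "y \<in> carrier_vec (l - i)" "\<And>t. t < l - i \<Longrightarrow> y $ t = u $ (t + i)" for u y
    proof (rule eq_vecI)
      fix k assume "k < dim_vec (encode K u)"
      then have k: "k < l" using encode_carrier[OF K, of u] by simp
      have "(B\<^sup>T *\<^sub>v y) $ k = (\<Sum>t = 0..<l - i. K $$ (t + i, k) * u $ (t + i))"
        using K B k u y i by (auto simp: scalar_prod_def B_def mat_of_rows_def ac_simps intro!: sum.cong)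
      also have "\<dots> = (\<Sum>j = 0 + i..<(l - i) + i. K $$ (j, k) * u $ j)"
        by (rule sum.shift_bounds_nat_ivl[symmetric])
      also have "\<dots> = (\<Sum>j<l. K $$ (j, k) * u $ j)"
        using u i by (intro sum.mono_neutral_left) auto
      finally show "(B\<^sup>T *\<^sub>v y) $ k = encode K u $ k"
        using encode_index[OF K u(1) k] by simp
    qed (use B encode_carrier[OF K, of u] in auto)
    show ?thesis
    proof (intro subset_antisym subsetI)
      fix w assume "w \<in> {B\<^sup>T *\<^sub>v y | y. y \<in> carrier_vec (l - i)}"
      then obtain y where y: "y \<in> carrier_vec (l - i)" "w = B\<^sup>T *\<^sub>v y" by auto
      define u where "u = vec l (\<lambda>j. if j < i then 0 else y $ (j - i))"
      have "u \<in> {u \<in> carrier_vec l. \<forall>j<i. u $ j = 0}" using i by (auto simp: u_def)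
      moreover have "w = encode K u"
        unfolding y(2) using y(1) i by (intro key) (auto simp: u_def)
      ultimately show "w \<in> encode K ` {u \<in> carrier_vec l. \<forall>j<i. u $ j = 0}" by blast
    next
      fix w assume "w \<in> encode K ` {u \<in> carrier_vec l. \<forall>j<i. u $ j = 0}"
      then obtain u where u: "u \<in> carrier_vec l" "\<forall>j<i. u $ j = 0" "w = encode K u" by auto
      have "w = B\<^sup>T *\<^sub>v vec (l - i) (\<lambda>t. u $ (t + i))"
        using key[OF u(1,2), of "vec (l - i) (\<lambda>t. u $ (t + i))"] u(3) by auto
      then show "w \<in> {B\<^sup>T *\<^sub>v y | y. y \<in> carrier_vec (l - i)}" by auto
    qed
  qed
  finally show ?thesis .
qed

text \<open>Self-duality at index 0 makes the full row space the dual of the zero code, that is, the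
  whole space. Encoding is therefore onto, and a surjection of a finite set onto itself is
  injective.\<close>

lemma self_dual_kernel_inj_on:
  assumes K: "K \<in> carrier_mat l l" and sd: "self_dual_kernel l K"
  shows "inj_on (encode K) (carrier_vec l)"
proof -
  have "kernel_code l K 0 = vec_module.orthogonal_complement l (kernel_code l K l)"
    using sd unfolding self_dual_kernel_def by (metis zero_le diff_zero)
  also have "\<dots> = carrier_vec l"
    by (auto simp: kernel_code_last vec_module.orthogonal_complement_def)
  finally have "encode K ` carrier_vec l = carrier_vec l"
    using kernel_code_eq[OF K, of 0] by simp
  then show ?thesis
    using finite_carrier_bit_vec by (simp add: finite_surj_inj eq_card_imp_inj_on)
qed

lemma encode_mem_kernel_code_iff:
  assumes K: "K \<in> carrier_mat l l" and inj: "inj_on (encode K) (carrier_vec l)"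
    and "i \<le> l" "u \<in> carrier_vec l"
  shows "encode K u \<in> kernel_code l K i \<longleftrightarrow> (\<forall>j<i. u $ j = 0)"
  unfolding kernel_code_eq[OF K \<open>i \<le> l\<close>]
  using inj_on_image_mem_iff[OF inj \<open>u \<in> carrier_vec l\<close>, of "{u \<in> carrier_vec l. \<forall>j<i. u $ j = 0}"]
    \<open>u \<in> carrier_vec l\<close> by blast

text \<open>Injectivity gives each codeword a single message, so lying outside the smaller code is
  decided by bit \<open>i\<close> of that message, where nonzero means 1.\<close>

lemma kernel_code_diff_eq:
  assumes K: "K \<in> carrier_mat l l" and inj: "inj_on (encode K) (carrier_vec l)" and i: "i < l"
  shows "kernel_code l K i - kernel_code l K (Suc i) =
    encode K ` {u \<in> carrier_vec l. (\<forall>j<i. u $ j = 0) \<and> u $ i = 1}"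
proof -
  have "c \<in> kernel_code l K i - kernel_code l K (Suc i) \<longleftrightarrow>
    (\<exists>u\<in>carrier_vec l. c = encode K u \<and> (\<forall>j<i. u $ j = 0) \<and> u $ i = 1)" for c
  proof (cases "c \<in> encode K ` carrier_vec l")
    case True
    then obtain u where u: "u \<in> carrier_vec l" "c = encode K u" by auto
    have "u = v" if "v \<in> carrier_vec l" "c = encode K v" for v
      using inj_onD[OF inj, of u v] that u by simp
    then show ?thesis
      using u i encode_mem_kernel_code_iff[OF K inj, of _ u] by (auto simp: less_Suc_eq)
  next
    case False
    then show ?thesis using i by (auto simp: kernel_code_eq[OF K])
  qed
  then show ?thesis by (auto simp: set_eq_iff)
qed

text \<open>By linearity only the sum of the two messages matters: its first nonzero bit is the one
  at which they differ, and their encodings agree where its encoding vanishes. Channel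
  \<open>Suc i\<close> reads the bit with library index \<open>i\<close>.\<close>

lemma uncorrectable_iff:
  assumes K: "K \<in> carrier_mat l l" and inj: "inj_on (encode K) (carrier_vec l)" and i: "i < l"
  shows "uncorrectable l K (Suc i) e \<longleftrightarrow>
    (\<exists>c \<in> kernel_code l K i - kernel_code l K (Suc i). \<forall>j<l. e $ j = 0 \<longrightarrow> c $ j = 0)"
    (is "?L \<longleftrightarrow> ?R")
proof -
  \<comment> \<open>Passes from numbering from 1 to library indices, absorbing every
    \<open>j - 1\<close>.\<close>
  have "{1..<Suc i} = Suc ` {..<i}" "{1..l} = Suc ` {..<l}"
    by (simp_all add: image_Suc_lessThan atLeastLessThanSuc_atLeastAtMost)
  then have L: "?L \<longleftrightarrow> (\<exists>u'\<in>carrier_vec l. \<exists>u''\<in>carrier_vec l. (\<forall>j<i. u' $ j = u'' $ j) \<and>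
      u' $ i \<noteq> u'' $ i \<and> (\<forall>j<l. e $ j = 0 \<longrightarrow> encode K u' $ j = encode K u'' $ j))"
    unfolding uncorrectable_def by (simp, simp only: Ball_def lessThan_iff)
  show ?thesis
  proof
    assume ?L
    then obtain u v where u: "u \<in> carrier_vec l" and v: "v \<in> carrier_vec l"
      and uv: "\<forall>j<i. u $ j = v $ j" "u $ i \<noteq> v $ i"
        "\<forall>j<l. e $ j = 0 \<longrightarrow> encode K u $ j = encode K v $ j"
      unfolding L by auto
    have "u + v \<in> {u \<in> carrier_vec l. (\<forall>j<i. u $ j = 0) \<and> u $ i = 1}"
      using u v uv i by (cases "u $ i"; cases "v $ i") auto
    then have "encode K (u + v) \<in> kernel_code l K i - kernel_code l K (Suc i)"
      unfolding kernel_code_diff_eq[OF K inj i] by blast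
    moreover have "encode K (u + v) $ j = 0" if "j < l" "e $ j = 0" for j
      using that uv(3) carrier_vecD[OF encode_carrier[OF K]] by (simp add: encode_add[OF K u v])
    ultimately show ?R by blast
  next
    assume ?R
    then obtain u where u: "u \<in> carrier_vec l" "\<forall>j<i. u $ j = 0" "u $ i = 1"
      "\<forall>j<l. e $ j = 0 \<longrightarrow> encode K u $ j = 0"
      unfolding kernel_code_diff_eq[OF K inj i] by auto
    \<comment> \<open>The second message is taken to be zero, so that agreement of the encodings
      becomes vanishing of the encoding of \<open>u\<close>.\<close>
    have "encode K (0\<^sub>v l) $ j = 0" if "j < l" for j
      using encode_index[OF K zero_carrier_vec that] by simp
    then show ?L unfolding L using u i
      by (intro bexI[of _ u] bexI[of _ "0\<^sub>v l"]) auto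
  qed
qed

text \<open>Self-duality identifies the duals of the two codes governing channel \<open>i\<close>
  with the codes governing channel \<open>l + 1 - i\<close>, so
  \<open>complementary_support_duality\<close> links the two channels.\<close>

lemma uncorrectable_dual_iff:
  assumes K: "K \<in> carrier_mat l l" and sd: "self_dual_kernel l K" and i: "1 \<le> i" "i \<le> l"
    and e: "\<And>j. j < l \<Longrightarrow> e' $ j = 1 + e $ j"
  shows "uncorrectable l K (l + 1 - i) e \<longleftrightarrow> \<not> uncorrectable l K i e'"
proof -
  note inj = self_dual_kernel_inj_on[OF K sd]
  obtain k where k: "i = Suc k" "k < l" using i by (cases i) auto
  let ?C = "kernel_code l K k" and ?D = "kernel_code l K (Suc k)"
  have D_perp: "kernel_code l K (l - Suc k) = vec_module.orthogonal_complement l ?D"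
    and C_perp: "kernel_code l K (l - k) = vec_module.orthogonal_complement l ?C"
    using sd[unfolded self_dual_kernel_def, rule_format, of "l - Suc k"]
      sd[unfolded self_dual_kernel_def, rule_format, of "l - k"] k by simp_all
  \<comment> \<open>Channel \<open>l + 1 - i\<close> compares the codes numbered
    \<open>l - Suc k\<close> and \<open>l - k\<close>. Passing to duals reverses inclusion, so the
    dual of \<open>?D\<close> is the larger one.\<close>
  have Suc_eq: "l + 1 - i = Suc (l - Suc k)" "Suc (l - Suc k) = l - k" using k by auto
  have C: "c \<in> ?C - ?D \<longleftrightarrow> (\<exists>u\<in>carrier_vec l. c = encode K u \<and> (\<forall>j<k. u $ j = 0) \<and> u $ k = 1)" for c
    unfolding kernel_code_diff_eq[OF K inj k(2)] by auto
  have D: "c \<in> ?D \<longleftrightarrow> (\<exists>u\<in>carrier_vec l. c = encode K u \<and> (\<forall>j<Suc k. u $ j = 0))" for c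
    using k by (auto simp: kernel_code_eq[OF K])
  \<comment> \<open>Reduces the closure and coset conditions on codewords to coordinate conditions
    \<open>P\<close> on messages.\<close>
  have encode_sum: "\<exists>w\<in>carrier_vec l. encode K u + encode K v = encode K w \<and> P w"
    if "u \<in> carrier_vec l" "v \<in> carrier_vec l" "P (u + v)" for u v P
    using that encode_add[OF K] by (intro bexI[of _ "u + v"]) auto
  \<comment> \<open>The set \<open>E\<close> of the duality lemma is the unerased part of
    \<open>e\<close>: \<open>d\<close> is supported on the erasures of \<open>e\<close>, and
    \<open>c\<close> on those of \<open>e'\<close>.\<close>
  have "(\<exists>d \<in> vec_module.orthogonal_complement l ?D - vec_module.orthogonal_complement l ?C.
            \<forall>j<l. j \<in> {j. e $ j = 0} \<longrightarrow> d $ j = 0) \<longleftrightarrow>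
         \<not> (\<exists>c \<in> ?C - ?D. \<forall>j<l. j \<notin> {j. e $ j = 0} \<longrightarrow> c $ j = 0)"
  proof (rule complementary_support_duality)
    show "?C \<subseteq> carrier_vec l" using k K by (auto simp: kernel_code_eq[OF K])
    show "0\<^sub>v l \<in> ?D"
      unfolding D using k K by (intro bexI[of _ "0\<^sub>v l"]) (auto simp: encode_def)
    \<comment> \<open>This word is the row of \<open>K\<close> with library index \<open>k\<close>;
      it makes the inclusion strict.\<close>
    have "encode K (unit_vec l k) \<in> ?C - ?D"
      unfolding C using k by (intro bexI[of _ "unit_vec l k"]) auto
    moreover have "?D \<subseteq> ?C" using k by (auto simp: kernel_code_eq[OF K])
    ultimately show "?D \<subset> ?C" by blast
    show "x + y \<in> ?D" if "x \<in> ?D" "y \<in> ?D" for x y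
      using that k unfolding D by (auto intro!: encode_sum)
    show "x + y \<in> ?C - ?D" if "x \<in> ?C - ?D" "y \<in> ?D" for x y
      using that k unfolding C D by (auto intro!: encode_sum)
    show "x + y \<in> ?D" if "x \<in> ?C - ?D" "y \<in> ?C - ?D" for x y
      using that k unfolding C D by (auto intro!: encode_sum simp: less_Suc_eq)
  qed
  then have "uncorrectable l K (Suc (l - Suc k)) e \<longleftrightarrow>
      \<not> (\<exists>c \<in> ?C - ?D. \<forall>j<l. e $ j \<noteq> 0 \<longrightarrow> c $ j = 0)"
    using k by (subst uncorrectable_iff[OF K inj]) (simp_all only: Suc_eq D_perp C_perp mem_Collect_eq)
  also have "(\<exists>c \<in> ?C - ?D. \<forall>j<l. e $ j \<noteq> 0 \<longrightarrow> c $ j = 0) \<longleftrightarrow>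
      (\<exists>c \<in> ?C - ?D. \<forall>j<l. e' $ j = 0 \<longrightarrow> c $ j = 0)"
  proof -
    have "e' $ j = 0 \<longleftrightarrow> e $ j \<noteq> 0" if "j < l" for j
      using e[OF that] by (cases "e $ j") auto
    then show ?thesis by blast
  qed
  also have "\<dots> \<longleftrightarrow> uncorrectable l K i e'"
    unfolding k(1) uncorrectable_iff[OF K inj k(2)] ..
  finally show ?thesis
    unfolding Suc_eq(1) .
qed

section \<open>Sums over erasure patterns and the polynomial identity\<close>

lemma hamming_weight_le: "e \<in> carrier_vec l \<Longrightarrow> hamming_weight e \<le> l"
  unfolding hamming_weight_def by (rule order_trans[OF card_mono[of "{..<l}"]]) auto

text \<open>Undoes the grouping by weight, so that patterns can be complemented one at a
  time.\<close>

lemma poly_polarization_poly: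
  "poly (polarization_poly l K i) z =
    (\<Sum>e | e \<in> carrier_vec l \<and> uncorrectable l K i e.
       z ^ hamming_weight e * (1 - z) ^ (l - hamming_weight e))"
proof -
  let ?U = "{e \<in> carrier_vec l. uncorrectable l K i e}"
  have fin: "finite ?U" using finite_carrier_bit_vec[of l] by simp
  have "(\<Sum>e\<in>?U. z ^ hamming_weight e * (1 - z) ^ (l - hamming_weight e)) =
    (\<Sum>w = 0..l. \<Sum>e | e \<in> ?U \<and> hamming_weight e = w.
       z ^ hamming_weight e * (1 - z) ^ (l - hamming_weight e))"
    using hamming_weight_le by (intro sum.group[OF fin, symmetric]) auto
  also have "\<dots> = (\<Sum>w = 0..l. of_nat (num_uncorrectable l K i w) * z ^ w * (1 - z) ^ (l - w))"
  proof (rule sum.cong[OF refl])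
    fix w
    have "{e. e \<in> ?U \<and> hamming_weight e = w} =
      {e \<in> carrier_vec l. hamming_weight e = w \<and> uncorrectable l K i e}" by auto
    then show "(\<Sum>e | e \<in> ?U \<and> hamming_weight e = w.
        z ^ hamming_weight e * (1 - z) ^ (l - hamming_weight e)) =
      of_nat (num_uncorrectable l K i w) * z ^ w * (1 - z) ^ (l - w)"
      by (simp add: num_uncorrectable_def)
  qed
  finally show ?thesis
    by (simp add: polarization_poly_def poly_sum)
qed

text \<open>Expanding the product of \<open>l\<close> factors \<open>z + (1 - z)\<close>, each equal
  to 1, gives one term per erasure set.\<close>

lemma sum_hamming_weight_total:
  fixes z :: real
  shows "(\<Sum>e\<in>carrier_vec l. z ^ hamming_weight e * (1 - z) ^ (l - hamming_weight e)) = 1"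
proof -
  let ?v = "\<lambda>S. vec l (\<lambda>j. of_bool (j \<in> S)) :: bit vec"
  have "(\<Sum>e\<in>carrier_vec l. z ^ hamming_weight e * (1 - z) ^ (l - hamming_weight e)) =
    (\<Sum>S\<in>Pow {..<l}. z ^ hamming_weight (?v S) * (1 - z) ^ (l - hamming_weight (?v S)))"
    by (rule sum.reindex_bij_betw[OF bij_betw_indicator_bit_vec, symmetric])
  also have "\<dots> = (\<Sum>S\<in>Pow {..<l}. (\<Prod>j\<in>S. z) * (\<Prod>j\<in>{..<l} - S. 1 - z))"
  proof (rule sum.cong[OF refl])
    fix S assume S: "S \<in> Pow {..<l}"
    then have "{j. j < l \<and> ?v S $ j \<noteq> 0} = S" by auto
    then have "hamming_weight (?v S) = card S" by (simp add: hamming_weight_def)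
    moreover have "card ({..<l} - S) = l - card S"
      using S by (subst card_Diff_subset) (auto intro: finite_subset)
    ultimately show "z ^ hamming_weight (?v S) * (1 - z) ^ (l - hamming_weight (?v S)) =
      (\<Prod>j\<in>S. z) * (\<Prod>j\<in>{..<l} - S. 1 - z)" by simp
  qed
  also have "\<dots> = (\<Prod>j<l. z + (1 - z))"
    by (rule prod_add[symmetric]) simp
  finally show ?thesis by simp
qed

theorem theorem2:
  fixes l i :: nat and K :: "bit mat" and z :: real
  assumes "K \<in> carrier_mat l l"
    and "self_dual_kernel l K"
    and "1 \<le> i" and "i \<le> l"
  shows "poly (polarization_poly l K (l + 1 - i)) z = 1 - poly (polarization_poly l K i) (1 - z)"
proof -
  \<comment> \<open>The summand of \<open>poly_polarization_poly\<close> at \<open>1 - z\<close>,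
    with \<open>1 - (1 - z)\<close> simplified to \<open>z\<close>.\<close>
  let ?p = "\<lambda>e. (1 - z) ^ hamming_weight e * z ^ (l - hamming_weight e)"
  define comp :: "bit vec \<Rightarrow> bit vec" where "comp e = vec l (\<lambda>j. 1 + e $ j)" for e
  have comp_comp: "comp (comp e) = e" if "e \<in> carrier_vec l" for e
    using that by (intro eq_vecI) (auto simp: comp_def add.assoc[symmetric])
  have comp_carrier: "comp e \<in> carrier_vec l" for e by (simp add: comp_def)
  have dual: "uncorrectable l K (l + 1 - i) e \<longleftrightarrow> \<not> uncorrectable l K i (comp e)" for e
    by (rule uncorrectable_dual_iff[OF assms]) (simp add: comp_def)
  have weight: "hamming_weight (comp e) = l - hamming_weight e" if e: "e \<in> carrier_vec l" for e
  proof -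
    have "{j. j < l \<and> comp e $ j \<noteq> 0} = {..<l} - {j. j < l \<and> e $ j \<noteq> 0}"
      by (auto simp: comp_def)
    then show ?thesis
      using e by (simp add: hamming_weight_def card_Diff_subset comp_def subset_eq)
  qed
  \<comment> \<open>The involution \<open>comp\<close> carries patterns uncorrectable for channel
    \<open>l + 1 - i\<close> to patterns correctable for channel \<open>i\<close> and exchanges the
    two exponents.\<close>
  have "poly (polarization_poly l K (l + 1 - i)) z =
    (\<Sum>e | e \<in> carrier_vec l \<and> \<not> uncorrectable l K i e. ?p e)"
    unfolding poly_polarization_poly
    by (rule sum.reindex_bij_witness[where i = comp and j = comp])
      (use hamming_weight_le in \<open>auto simp: comp_comp comp_carrier dual[simplified] weight mult.commute\<close>)
  also have "\<dots> = (\<Sum>e\<in>carrier_vec l. ?p e) - (\<Sum>e | e \<in> carrier_vec l \<and> uncorrectable l K i e. ?p e)"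
    using finite_carrier_bit_vec[of l]
    by (subst sum_diff[symmetric]) (auto intro!: sum.cong)
  also have "\<dots> = 1 - poly (polarization_poly l K i) (1 - z)"
    using sum_hamming_weight_total[of "1 - z" l] by (simp add: poly_polarization_poly)
  finally show ?thesis .
qed

end
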